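(* The set $\mathbb Z$ is a topological ring with respect to the usual addition and multiplication and the topology $\mathcal T$.
   Context: $\mathbb N^*$ denotes the set of positive integers. For $a\in\mathbb Z$ and $b\in\mathbb N^*$, $a+b\mathbb Z:=\{a+bn:n\in\mathbb Z\}$. The topology $\mathcal T$ on $\mathbb Z$ (Fürstenberg's topology) is defined as follows: a set $A\subset\mathbb Z$ is open (belongs to $\mathcal T$) if, for each $a\in A$, there is $b\in\mathbb N^*$ such that $a+b\mathbb Z\subset A$. A topological ring is a ring which is at the same time a topological space such that the ring operations (addition and multiplication) are continuous with respect to the product topology, and so is the additive inversion. *)

theory Defs
  imports "HOL-Algebra.IntRing" "HOL-Analysis.Product_Topology"
begin

definition arith_prog :: "int \<Rightarrow> int \<Rightarrow> int set"
  where "arith_prog a b = {a + b * n | n. n \<in> UNIV}"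

definition furstenberg_topology :: "int topology"
  where "furstenberg_topology = topology (\<lambda>A. \<forall>a\<in>A. \<exists>b>0. arith_prog a b \<subseteq> A)"

text \<open>
  The constant \<^const>\<open>topology\<close> is only meaningful on predicates satisfying
  \<^const>\<open>istopology\<close>, which is therefore checked here.
\<close>

lemma openin_furstenberg_topology:
  "openin furstenberg_topology A \<longleftrightarrow> (\<forall>a\<in>A. \<exists>b>0. arith_prog a b \<subseteq> A)"
proof -
  have "\<exists>b>0. arith_prog a b \<subseteq> S \<inter> T"
    if S: "\<forall>a\<in>S. \<exists>b>0. arith_prog a b \<subseteq> S" and T: "\<forall>a\<in>T. \<exists>b>0. arith_prog a b \<subseteq> T"
      and a: "a \<in> S \<inter> T" for S T a
  proof -
    obtain b c where b: "b > 0" "arith_prog a b \<subseteq> S" and c: "c > 0" "arith_prog a c \<subseteq> T"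
      using S T a by blast
    have "arith_prog a (b * c) \<subseteq> arith_prog a b"
      unfolding arith_prog_def by (auto simp: mult.assoc)
    moreover have "arith_prog a (b * c) \<subseteq> arith_prog a c"
      unfolding arith_prog_def by (auto simp: mult.assoc mult.left_commute)
    moreover have "b * c > 0"
      using b c by simp
    ultimately show ?thesis
      using b c by blast
  qed
  moreover have "\<exists>b>0. arith_prog a b \<subseteq> \<Union>K"
    if K: "\<forall>S\<in>K. \<forall>a\<in>S. \<exists>b>0. arith_prog a b \<subseteq> S" and a: "a \<in> \<Union>K" for K a
  proof -
    obtain S where S: "S \<in> K" "a \<in> S"
      using a by (rule UnionE)
    with K obtain b where b: "b > 0" "arith_prog a b \<subseteq> S"
      by metis
    have "S \<subseteq> \<Union>K"
      using S(1) by (rule Union_upper)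
    with b(2) have "arith_prog a b \<subseteq> \<Union>K"
      by (rule subset_trans)
    with b(1) show ?thesis
      by (intro exI conjI)
  qed
  ultimately have "istopology (\<lambda>A. \<forall>a\<in>A. \<exists>b>0. arith_prog a b \<subseteq> A)"
    unfolding istopology_def by (intro conjI allI impI ballI) assumption+
  then show ?thesis
    by (simp add: furstenberg_topology_def topology_inverse')
qed

lemma topspace_furstenberg_topology: "topspace furstenberg_topology = UNIV"
proof -
  have "openin furstenberg_topology UNIV"
    unfolding openin_furstenberg_topology using zero_less_one by (meson subset_UNIV)
  then show ?thesis
    using openin_subset by blast
qed

definition topological_ring :: "('a, 'b) ring_scheme \<Rightarrow> 'a topology \<Rightarrow> bool"
  where "topological_ring R T \<longleftrightarrow>
    ring R \<and> topspace T = carrier R \<and>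
    continuous_map (prod_topology T T) T (\<lambda>(x, y). x \<oplus>\<^bsub>R\<^esub> y) \<and>
    continuous_map (prod_topology T T) T (\<lambda>(x, y). x \<otimes>\<^bsub>R\<^esub> y) \<and>
    continuous_map T T (\<lambda>x. \<ominus>\<^bsub>R\<^esub> x)"

end

theory Submission imports Defs begin

text \<open>
  The ring operations respect congruences, so addition and multiplication map the product of two progressions with
  common difference \<open>b\<close> into a single progression with difference \<open>b\<close>.
\<close>

text \<open>Rewriting membership as a congruence modulo \<open>b\<close> removes the existential
  witness, so that the later inclusions become divisibility facts.\<close>

lemma mem_arith_prog: "x \<in> arith_prog a b \<longleftrightarrow> b dvd x - a"
proof -
  have "x = a + b * n \<longleftrightarrow> x - a = b * n" for n
    by linarith
  then show ?thesis
    by (auto simp: arith_prog_def dvd_def)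
qed

text \<open>A progression can be recentred at any of its elements \<open>c\<close> with the same
  difference, so \<open>b\<close> itself witnesses openness at every point.\<close>

lemma openin_arith_prog:
  assumes "b > 0"
  shows "openin furstenberg_topology (arith_prog a b)"
  unfolding openin_furstenberg_topology
proof
  fix c assume c: "c \<in> arith_prog a b"
  have "arith_prog c b \<subseteq> arith_prog a b"
  proof
    fix x assume "x \<in> arith_prog c b"
    \<comment> \<open>Transitivity of congruence: \<open>x - a\<close> telescopes through the new
      centre \<open>c\<close>.\<close>
    with c have "b dvd (x - c) + (c - a)"
      unfolding mem_arith_prog by (intro dvd_add)
    then show "x \<in> arith_prog a b"
      by (simp add: mem_arith_prog)
  qed
  with assms show "\<exists>d>0. arith_prog c d \<subseteq> arith_prog a b"
    by blast
qed

text \<open>The difference never has to shrink: if the progression through \<open>f a\<close> with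
  difference \<open>b\<close> lies in \<open>U\<close>, then \<open>f\<close> sends the progression
  through \<open>a\<close> with that same difference into it.\<close>

lemma continuous_map_furstenberg:
  assumes "\<And>x y b. b dvd x - y \<Longrightarrow> b dvd f x - f y"
  shows "continuous_map furstenberg_topology furstenberg_topology f"
  unfolding continuous_map_def topspace_furstenberg_topology
proof (intro conjI allI impI)
  fix U assume "openin furstenberg_topology U"
  then have U: "\<exists>b>0. arith_prog u b \<subseteq> U" if "u \<in> U" for u
    using that by (simp add: openin_furstenberg_topology)
  show "openin furstenberg_topology {x \<in> UNIV. f x \<in> U}"
    unfolding openin_furstenberg_topology
  proof
    fix a assume "a \<in> {x \<in> UNIV. f x \<in> U}"
    then obtain b where "b > 0" "arith_prog (f a) b \<subseteq> U"
      using U by auto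
    then show "\<exists>b>0. arith_prog a b \<subseteq> {x \<in> UNIV. f x \<in> U}"
      using assms by (intro exI[of _ b]) (auto simp: mem_arith_prog subset_iff)
  qed
qed simp

lemma continuous_map_furstenberg_prod:
  assumes "\<And>x x' y y' b. b dvd x - x' \<Longrightarrow> b dvd y - y' \<Longrightarrow> b dvd f x y - f x' y'"
  shows "continuous_map (prod_topology furstenberg_topology furstenberg_topology)
    furstenberg_topology (\<lambda>(x, y). f x y)"
  unfolding continuous_map_def topspace_furstenberg_topology topspace_prod_topology
proof (intro conjI allI impI)
  fix U assume "openin furstenberg_topology U"
  then have U: "\<exists>b>0. arith_prog u b \<subseteq> U" if "u \<in> U" for u
    using that by (simp add: openin_furstenberg_topology)
  show "openin (prod_topology furstenberg_topology furstenberg_topology)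
    {p \<in> UNIV \<times> UNIV. (case p of (x, y) \<Rightarrow> f x y) \<in> U}"
    unfolding openin_prod_topology_alt
  proof (intro allI impI)
    fix x y assume "(x, y) \<in> {p \<in> UNIV \<times> UNIV. (case p of (x, y) \<Rightarrow> f x y) \<in> U}"
    then obtain b where b: "b > 0" "arith_prog (f x y) b \<subseteq> U"
      using U by auto
    \<comment> \<open>Both sides of the box take the difference \<open>b\<close> found at
      \<open>f x y\<close>; any point of the box is congruent to \<open>(x, y)\<close> in each
      coordinate, so its image stays in \<open>arith_prog (f x y) b\<close>.\<close>
    show "\<exists>V W. openin furstenberg_topology V \<and> openin furstenberg_topology W \<and>
      x \<in> V \<and> y \<in> W \<and> V \<times> W \<subseteq> {p \<in> UNIV \<times> UNIV. (case p of (x, y) \<Rightarrow> f x y) \<in> U}"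
      using b assms
      by (intro exI[of _ "arith_prog x b"] exI[of _ "arith_prog y b"])
        (auto simp: openin_arith_prog mem_arith_prog subset_iff)
  qed
qed simp

theorem theorem3: "topological_ring \<Z> furstenberg_topology"
  unfolding topological_ring_def
proof (intro conjI)
  show "ring \<Z>"
    using int_is_cring by (rule cring.axioms)
  show "topspace furstenberg_topology = carrier \<Z>"
    by (simp add: topspace_furstenberg_topology)
  have "b dvd (x + y) - (x' + y')" if "b dvd x - x'" "b dvd y - y'" for b x x' y y' :: int
    using dvd_add[OF that] by (simp add: algebra_simps)
  then show "continuous_map (prod_topology furstenberg_topology furstenberg_topology)
      furstenberg_topology (\<lambda>(x, y). x \<oplus>\<^bsub>\<Z>\<^esub> y)"
    by (intro continuous_map_furstenberg_prod) simp
  have "b dvd x * y - x' * y'" if "b dvd x - x'" "b dvd y - y'" for b x x' y y' :: int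
  proof -
    \<comment> \<open>Change one factor at a time: the mixed term \<open>x' * y\<close> cancels, and
      each summand contains a difference divisible by \<open>b\<close>.\<close>
    have "x * y - x' * y' = (x - x') * y + x' * (y - y')"
      by (simp add: algebra_simps)
    with that show ?thesis
      by simp
  qed
  then show "continuous_map (prod_topology furstenberg_topology furstenberg_topology)
      furstenberg_topology (\<lambda>(x, y). x \<otimes>\<^bsub>\<Z>\<^esub> y)"
    by (intro continuous_map_furstenberg_prod) simp
  \<comment> \<open>The difference of the negatives is \<open>y - x\<close>, and divisibility
    ignores the sign.\<close>
  have "b dvd (- x) - (- y)" if "b dvd x - y" for b x y :: int
    using that by (simp add: dvd_diff_commute)
  then show "continuous_map furstenberg_topology furstenberg_topology (\<lambda>x. \<ominus>\<^bsub>\<Z>\<^esub> x)"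
    by (intro continuous_map_furstenberg) (simp add: int_a_inv_eq)
qed

end
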